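(* Let $f(z)=z+\sum_{n\ge 2}a_nz^n$ belong to $\mathcal{S}^*_B$, and let $\mathcal{T}_{2,3}(f)=a_3^2-a_4^2$. Then $$|\mathcal{T}_{2,3}(f)|\le \frac{545}{648}.$$ This inequality is sharp, i.e. equality holds for some function in $\mathcal{S}^*_B$.
   Context: Let $\mathbb{D}=\{z\in\mathbb{C}:|z|<1\}$ and let $\mathcal{A}$ be the class of analytic functions $f$ on $\mathbb{D}$ with $f(0)=0$, $f'(0)=1$, written $f(z)=z+\sum_{n=2}^\infty a_nz^n$. For analytic functions $g,h$ on $\mathbb{D}$, $g\prec h$ ($g$ is subordinate to $h$) means $g(z)=h(w(z))$ on $\mathbb{D}$ for some analytic $w:\mathbb{D}\to\mathbb{D}$ with $w(0)=0$. Let $B(z)=\dfrac{1}{1-\log(1+z)}$ on $\mathbb{D}$ (principal branch of the logarithm), and let $$\mathcal{S}^*_B=\left\{f\in\mathcal{A}:\ \frac{zf'(z)}{f(z)}\prec B(z)\right\}.$$ *)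

theory Defs
  imports "HOL-Complex_Analysis.Complex_Analysis"
begin

abbreviation unit_disc :: "complex set" where
  "unit_disc \<equiv> ball 0 1"

definition class_A :: "(complex \<Rightarrow> complex) set" where
  "class_A = {f. f holomorphic_on unit_disc \<and> f 0 = 0 \<and> deriv f 0 = 1}"

definition subordinate :: "(complex \<Rightarrow> complex) \<Rightarrow> (complex \<Rightarrow> complex) \<Rightarrow> bool" where
  "subordinate g h \<longleftrightarrow>
     g holomorphic_on unit_disc \<and> h holomorphic_on unit_disc \<and>
     (\<exists>w. w holomorphic_on unit_disc \<and> w ` unit_disc \<subseteq> unit_disc \<and> w 0 = 0 \<and>
          (\<forall>z\<in>unit_disc. g z = h (w z)))"

definition B_fun :: "complex \<Rightarrow> complex" where
  "B_fun z = 1 / (1 - Ln (1 + z))"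

text \<open>The function \<open>z f'(z) / f(z)\<close>, with its removable singularity at the origin filled in:
  for \<open>f\<close> in \<open>class_A\<close> the limit there is 1, whereas HOL division would give 0.\<close>

definition log_deriv_quotient :: "(complex \<Rightarrow> complex) \<Rightarrow> complex \<Rightarrow> complex" where
  "log_deriv_quotient f z = (if z = 0 then 1 else z * deriv f z / f z)"

text \<open>That \<open>z f'(z) / f(z)\<close> is an analytic function on the disc presupposes that \<open>f\<close> has no
  zero other than the origin; this is stated explicitly because of \<open>x / 0 = 0\<close> in HOL.\<close>

definition starlike_B :: "(complex \<Rightarrow> complex) set" where
  "starlike_B = {f \<in> class_A. (\<forall>z\<in>unit_disc - {0}. f z \<noteq> 0) \<and>
                              subordinate (log_deriv_quotient f) B_fun}"

definition taylor_coeff :: "(complex \<Rightarrow> complex) \<Rightarrow> nat \<Rightarrow> complex" where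
  "taylor_coeff f n = (deriv ^^ n) f 0 / fact n"

definition T_2_3 :: "(complex \<Rightarrow> complex) \<Rightarrow> complex" where
  "T_2_3 f = (taylor_coeff f 3)\<^sup>2 - (taylor_coeff f 4)\<^sup>2"

end

theory Submission
  imports Defs
begin

text \<open>
  If \<open>z f' / f = B \<circ> w\<close> with \<open>w = c\<^sub>1 z + c\<^sub>2 z\<^sup>2 + \<dots>\<close>, comparing coefficients gives
  \<open>2 a\<^sub>3 = c\<^sub>2 + 3/2 c\<^sub>1\<^sup>2\<close> and \<open>3 a\<^sub>4 = c\<^sub>3 + 5/2 c\<^sub>1 c\<^sub>2 + 19/12 c\<^sub>1\<^sup>3\<close>.
  Both combinations are largest in modulus for \<open>w = e z\<close> with \<open>\<bar>e\<bar> = 1\<close>, so that \<open>\<bar>a\<^sub>3\<bar> \<le> 3/4\<close>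
  and \<open>\<bar>a\<^sub>4\<bar> \<le> 19/36\<close>; for the cubic one this is a case of the Prokhorov--Szynal inequality and
  follows from the Schur parametrisation of the coefficients of \<open>w\<close>. Hence
  \<open>\<bar>a\<^sub>3\<^sup>2 - a\<^sub>4\<^sup>2\<bar> \<le> 9/16 + 361/1296\<close>. For \<open>w = \<i> z\<close> the squares \<open>a\<^sub>3\<^sup>2\<close> and \<open>a\<^sub>4\<^sup>2\<close> have opposite
  signs, which gives equality.
\<close>

unbundle no vec_syntax

section \<open>Schur's algorithm and the coefficients of Schwarz functions\<close>

text \<open>A Moebius map sends \<open>f 0\<close> to 0, and the Schwarz lemma lets the result be
  divided by \<open>z\<close>. With the denominator cleared, the identity also covers the degenerate
  case: if modulus 1 is attained, \<open>f\<close> is constant by the maximum principle and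
  \<open>g = 0\<close> serves.\<close>

lemma schur_step:
  fixes f :: "complex \<Rightarrow> complex"
  assumes hol: "f holomorphic_on unit_disc"
    and bd: "\<And>z. z \<in> unit_disc \<Longrightarrow> norm (f z) \<le> 1"
  obtains g where "g holomorphic_on unit_disc" "\<And>z. z \<in> unit_disc \<Longrightarrow> norm (g z) \<le> 1"
    "\<And>z. z \<in> unit_disc \<Longrightarrow> f z - f 0 = (1 - cnj (f 0) * f z) * (z * g z)"
proof (cases "\<forall>z\<in>unit_disc. norm (f z) < 1")
  case True
  then have f0: "norm (f 0) < 1"
    by simp
  define M where "M = (\<lambda>z. Moebius_function 0 (f 0) (f z))"
  have holM: "M holomorphic_on unit_disc"
  proof -
    have "f ` unit_disc \<subseteq> unit_disc"
      using True by auto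
    then show ?thesis
      using holomorphic_on_compose_gen[OF hol Moebius_function_holomorphic[OF f0]]
      by (simp add: M_def o_def)
  qed
  have M0: "M 0 = 0"
    by (simp add: M_def Moebius_function_eq_zero)
  have M1: "norm (M z) < 1" if "norm z < 1" for z
    using True that f0 by (simp add: M_def Moebius_function_norm_lt_1)
  obtain g where g: "g holomorphic_on unit_disc" "\<And>z. norm z < 1 \<Longrightarrow> M z = z * g z"
      "deriv M 0 = g 0"
    using Schwarz3[OF holM M0] by blast
  show ?thesis
  proof (rule that[of g])
    fix z :: complex assume z: "z \<in> unit_disc"
    have "norm z * norm (g z) \<le> norm z"
      using Schwarz_Lemma(1)[OF holM M0 M1, of z] g(2)[of z] z by (simp add: norm_mult)
    moreover have "norm (g 0) \<le> 1"
      using Schwarz_Lemma(2)[OF holM M0 M1, of z] g(3) z by simp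
    ultimately show "norm (g z) \<le> 1"
      by (cases "z = 0") auto
    have "norm (cnj (f 0) * f z) < 1"
      using True z f0 norm_mult_less[of "cnj (f 0)" 1 "f z" 1] by simp
    then have "1 - cnj (f 0) * f z \<noteq> 0"
      by auto
    moreover have "(f z - f 0) / (1 - cnj (f 0) * f z) = z * g z"
      using g(2)[of z] z by (simp add: M_def Moebius_function_simple)
    ultimately show "f z - f 0 = (1 - cnj (f 0) * f z) * (z * g z)"
      by (simp add: field_simps)
  qed fact
next
  case False
  then obtain a where a: "a \<in> unit_disc" "norm (f a) = 1"
    using bd by force
  have "f constant_on unit_disc"
    by (rule maximum_modulus_principle[OF hol, of unit_disc a]) (use a bd in auto)
  then obtain c where c: "\<And>z. z \<in> unit_disc \<Longrightarrow> f z = c"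
    by (auto simp: constant_on_def)
  with a have "norm c = 1"
    by auto
  then have "cnj c * c = 1"
    using complex_norm_square[of c] by (simp add: mult.commute)
  then show ?thesis
    by (intro that[of "\<lambda>_. 0"]) (auto simp: c)
qed

lemma fps_expansion_disc [intro]:
  assumes "f holomorphic_on unit_disc"
  shows "f has_fps_expansion fps_expansion f 0"
  using assms by (intro has_fps_expansion_fps_expansion[of unit_disc]) auto

lemma fps_expansion_eqI:
  fixes F G :: "complex fps"
  assumes "f has_fps_expansion F" "g has_fps_expansion G"
    and eq: "\<And>z. z \<in> unit_disc \<Longrightarrow> f z = g z"
  shows "F = G"
proof -
  have "eventually (\<lambda>z::complex. z \<in> unit_disc) (nhds 0)"
    by (intro eventually_nhds_in_open) auto
  then have "eventually (\<lambda>z. f z = g z) (nhds 0)"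
    by eventually_elim (rule eq)
  then have "f has_fps_expansion G"
    using assms(2) has_fps_expansion_cong by blast
  with assms(1) show ?thesis
    using fps_expansion_unique_complex by blast
qed

lemmas fps_low_coeffs = fps_mult_nth numeral_eq_Suc sum.atLeast0_atMost_Suc

lemma schur_step_coeffs:
  assumes f: "f holomorphic_on unit_disc" and g: "g holomorphic_on unit_disc"
    and eq: "\<And>z. z \<in> unit_disc \<Longrightarrow> f z - f 0 = (1 - cnj (f 0) * f z) * (z * g z)"
  defines "F \<equiv> fps_expansion f 0" and "G \<equiv> fps_expansion g 0"
  shows "F $ 1 = (1 - cnj (F $ 0) * F $ 0) * G $ 0"
    and "F $ 2 = (1 - cnj (F $ 0) * F $ 0) * (G $ 1 - cnj (F $ 0) * (G $ 0)\<^sup>2)"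
    and "f 0 = 0 \<Longrightarrow> F $ Suc n = G $ n"
proof -
  have F0: "f 0 = F $ 0"
    by (simp add: F_def fps_expansion_def)
  have FG: "F - fps_const (F $ 0) = (1 - fps_const (cnj (F $ 0)) * F) * (fps_X * G)"
  proof (rule fps_expansion_eqI)
    show "(\<lambda>z. f z - f 0) has_fps_expansion F - fps_const (F $ 0)"
      unfolding F0 F_def by (intro fps_expansion_intros fps_expansion_disc f)
    show "(\<lambda>z. (1 - cnj (f 0) * f z) * (z * g z)) has_fps_expansion
            (1 - fps_const (cnj (F $ 0)) * F) * (fps_X * G)"
      unfolding F0 F_def G_def by (intro fps_expansion_intros fps_expansion_disc f g)
  qed (rule eq)
  show F1: "F $ 1 = (1 - cnj (F $ 0) * F $ 0) * G $ 0"
    using arg_cong[OF FG, of "\<lambda>H. H $ 1"] by (simp add: fps_low_coeffs)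
  have "F $ 2 = (1 - cnj (F $ 0) * F $ 0) * G $ 1 - cnj (F $ 0) * F $ 1 * G $ 0"
    using arg_cong[OF FG, of "\<lambda>H. H $ 2"] by (simp add: fps_low_coeffs)
  then show "F $ 2 = (1 - cnj (F $ 0) * F $ 0) * (G $ 1 - cnj (F $ 0) * (G $ 0)\<^sup>2)"
    unfolding F1 by (simp add: algebra_simps power2_eq_square)
  show "F $ Suc n = G $ n" if "f 0 = 0"
    using arg_cong[OF FG, of "\<lambda>H. H $ Suc n"] that F0 by simp
qed

text \<open>The coefficients are parametrised by the first three Schur parameters \<open>a\<close>, \<open>b\<close>, \<open>c\<close>.\<close>

lemma schwarz_function_coeffs:
  assumes w: "w holomorphic_on unit_disc" "w ` unit_disc \<subseteq> unit_disc" "w 0 = 0"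
  defines "W \<equiv> fps_expansion w 0"
  obtains a b c :: complex where "norm a \<le> 1" "norm b \<le> 1" "norm c \<le> 1"
    "W $ 1 = a" "W $ 2 = (1 - (norm a)\<^sup>2) * b"
    "W $ 3 = (1 - (norm a)\<^sup>2) * ((1 - (norm b)\<^sup>2) * c - cnj a * b\<^sup>2)"
proof -
  have "norm (w z) \<le> 1" if "z \<in> unit_disc" for z
    using w(2) that by (force simp: image_subset_iff)
  then obtain f where f: "f holomorphic_on unit_disc" "\<And>z. z \<in> unit_disc \<Longrightarrow> norm (f z) \<le> 1"
      "\<And>z. z \<in> unit_disc \<Longrightarrow> w z - w 0 = (1 - cnj (w 0) * w z) * (z * f z)"
    using schur_step[OF w(1)] by metis
  obtain g where g: "g holomorphic_on unit_disc" "\<And>z. z \<in> unit_disc \<Longrightarrow> norm (g z) \<le> 1"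
      "\<And>z. z \<in> unit_disc \<Longrightarrow> f z - f 0 = (1 - cnj (f 0) * f z) * (z * g z)"
    using schur_step[OF f(1,2)] by metis
  obtain h where h: "h holomorphic_on unit_disc" "\<And>z. z \<in> unit_disc \<Longrightarrow> norm (h z) \<le> 1"
      "\<And>z. z \<in> unit_disc \<Longrightarrow> g z - g 0 = (1 - cnj (g 0) * g z) * (z * h z)"
    using schur_step[OF g(1,2)] by metis
  have nth_0: "fps_expansion k 0 $ 0 = k 0" for k
    by (simp add: fps_expansion_def)
  have sq: "cnj x * x = (norm x)\<^sup>2" for x
    using complex_norm_square[of x] by (simp add: mult.commute)
  \<comment> \<open>Since \<open>w 0 = 0\<close>, the first step merely divides by \<open>z\<close>,
    so \<open>W\<close> is the expansion of \<open>f\<close> shifted by one; the Schur parameters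
    are \<open>f 0\<close>, \<open>g 0\<close>, \<open>h 0\<close>.\<close>
  note W = schur_step_coeffs(3)[OF w(1) f(1,3) w(3), folded W_def]
  note F = schur_step_coeffs(1,2)[OF f(1) g(1,3), unfolded nth_0 sq]
  note G = schur_step_coeffs(1)[OF g(1) h(1,3), unfolded nth_0 sq]
  show ?thesis
  proof (rule that[of "f 0" "g 0" "h 0"])
    show "W $ 1 = f 0"
      using W[of 0] by (simp add: nth_0)
    show "W $ 2 = (1 - (norm (f 0))\<^sup>2) * g 0"
      using W[of 1] F(1) by (simp add: numeral_2_eq_2)
    show "W $ 3 = (1 - (norm (f 0))\<^sup>2) * ((1 - (norm (g 0))\<^sup>2) * h 0 - cnj (f 0) * (g 0)\<^sup>2)"
      using W[of 2] F(2) G by (simp add: eval_nat_numeral)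
  qed (use f(2) g(2) h(2) in auto)
qed

section \<open>Sharp bounds for quadratic and cubic coefficient combinations\<close>

text \<open>With \<open>m = \<mu> \<surd>d / (2 \<surd>\<nu>)\<close>, the left-hand side is the quadratic form of the symmetric matrix
  with rows \<open>(a, m)\<close> and \<open>(m, -cnj a)\<close> at the vector \<open>(\<surd>\<nu> a, \<surd>d b)\<close>. That matrix is
  \<open>\<surd>(\<bar>a\<bar>\<^sup>2 + m\<^sup>2)\<close> times a unitary one, hence a contraction; \<open>P\<close> and \<open>Q\<close> are, up to scaling, the
  entries of its product with the vector.\<close>

lemma norm_mixed_form_le:
  fixes a b :: complex and \<mu> \<nu> d :: real
  assumes "0 < \<nu>" "0 \<le> d" "\<mu>\<^sup>2 \<le> 4 * \<nu>" "(norm a)\<^sup>2 + d = 1"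
  shows "norm (\<nu> * a ^ 3 + \<mu> * d * a * b - d * cnj a * b\<^sup>2) \<le> \<nu> * (norm a)\<^sup>2 + d * (norm b)\<^sup>2"
proof -
  define P where "P = \<nu> * a\<^sup>2 + \<mu> / 2 * d * b"
  define Q where "Q = \<mu> / 2 * a - cnj a * b"
  define S where "S = \<nu> * (norm a)\<^sup>2 + d * (norm b)\<^sup>2"
  \<comment> \<open>The mixed terms, multiples of \<open>Re (a\<^sup>2 * cnj b)\<close>, cancel
    between the two squares, and what remains factors.\<close>
  have "(norm P)\<^sup>2 + \<nu> * d * (norm Q)\<^sup>2 = S * (\<nu> * (norm a)\<^sup>2 + \<mu>\<^sup>2 / 4 * d)"
    unfolding S_def P_def Q_def cmod_power2
    by (simp add: power2_eq_square field_simps)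
  also have "\<dots> \<le> S * (\<nu> * (norm a)\<^sup>2 + \<nu> * d)"
    using assms by (intro mult_left_mono add_left_mono mult_right_mono) (auto simp: S_def)
  also have "\<dots> = S * \<nu>"
    using assms(4) by (metis distrib_left mult.right_neutral)
  finally have "(norm P)\<^sup>2 / \<nu> + d * (norm Q)\<^sup>2 \<le> S"
    using \<open>0 < \<nu>\<close> by (simp add: field_simps)
  \<comment> \<open>This and the next bound are AM-GM with weights \<open>\<nu>\<close> and
    \<open>d\<close>; their right-hand sides add up to at most \<open>2 * S\<close>.\<close>
  moreover have "2 * (norm a * norm P) \<le> \<nu> * (norm a)\<^sup>2 + (norm P)\<^sup>2 / \<nu>"
  proof -
    have "0 \<le> (\<nu> * norm a - norm P)\<^sup>2 / \<nu>"
      using \<open>0 < \<nu>\<close> by simp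
    also have "\<dots> = \<nu> * (norm a)\<^sup>2 + (norm P)\<^sup>2 / \<nu> - 2 * (norm a * norm P)"
      using \<open>0 < \<nu>\<close> by (simp add: field_simps power2_eq_square)
    finally show ?thesis
      by simp
  qed
  moreover have "d * (2 * (norm b * norm Q)) \<le> d * ((norm b)\<^sup>2 + (norm Q)\<^sup>2)"
    using sum_squares_bound[of "norm b" "norm Q"] \<open>0 \<le> d\<close>
    by (intro mult_left_mono) (auto simp: mult.assoc)
  ultimately have "norm a * norm P + d * (norm b * norm Q) \<le> S"
    by (simp add: S_def algebra_simps)
  moreover have "\<nu> * a ^ 3 + \<mu> * d * a * b - d * cnj a * b\<^sup>2 = a * P + d * (b * Q)"
    by (simp add: P_def Q_def algebra_simps power2_eq_square power3_eq_cube)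
  then have "norm (\<nu> * a ^ 3 + \<mu> * d * a * b - d * cnj a * b\<^sup>2) \<le> norm a * norm P + d * (norm b * norm Q)"
    using norm_triangle_ineq[of "a * P" "d * (b * Q)"] \<open>0 \<le> d\<close> by (simp add: norm_mult)
  ultimately show ?thesis
    by (simp add: S_def)
qed

text \<open>The third Schur parameter enters linearly and costs at most
  \<open>d * (1 - (norm b)\<^sup>2)\<close>. Added to the bound for the mixed form, this cancels the
  dependence on \<open>b\<close> and leaves \<open>\<nu> * (norm a)\<^sup>2 + d\<close>, at most
  \<nu> because 1 \<le> \<nu>.\<close>

lemma prokhorov_szynal:
  assumes w: "w holomorphic_on unit_disc" "w ` unit_disc \<subseteq> unit_disc" "w 0 = 0"
    and "\<mu>\<^sup>2 \<le> 4 * \<nu>" "1 \<le> \<nu>"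
  defines "W \<equiv> fps_expansion w 0"
  shows "norm (W $ 3 + of_real \<mu> * (W $ 1) * (W $ 2) + of_real \<nu> * (W $ 1) ^ 3) \<le> \<nu>"
proof -
  obtain a b c :: complex where abc: "norm a \<le> 1" "norm b \<le> 1" "norm c \<le> 1"
    "W $ 1 = a" "W $ 2 = (1 - (norm a)\<^sup>2) * b"
    "W $ 3 = (1 - (norm a)\<^sup>2) * ((1 - (norm b)\<^sup>2) * c - cnj a * b\<^sup>2)"
    using schwarz_function_coeffs[OF w] unfolding W_def by metis
  define d where "d = 1 - (norm a)\<^sup>2"
  have d: "0 \<le> d" "(norm a)\<^sup>2 + d = 1" "0 \<le> 1 - (norm b)\<^sup>2"
    using abc(1,2) by (auto simp: d_def power_le_one)
  have "W $ 3 + of_real \<mu> * (W $ 1) * (W $ 2) + of_real \<nu> * (W $ 1) ^ 3 =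
      (\<nu> * a ^ 3 + \<mu> * d * a * b - d * cnj a * b\<^sup>2) + of_real (d * (1 - (norm b)\<^sup>2)) * c"
    unfolding abc by (simp add: d_def algebra_simps)
  also have "norm \<dots> \<le> (\<nu> * (norm a)\<^sup>2 + d * (norm b)\<^sup>2) + d * (1 - (norm b)\<^sup>2)"
  proof (rule norm_triangle_le, rule add_mono)
    show "norm (\<nu> * a ^ 3 + \<mu> * d * a * b - d * cnj a * b\<^sup>2) \<le> \<nu> * (norm a)\<^sup>2 + d * (norm b)\<^sup>2"
      using d assms by (intro norm_mixed_form_le) auto
    have "norm (of_real (d * (1 - (norm b)\<^sup>2)) * c) = d * (1 - (norm b)\<^sup>2) * norm c"
      using d by (simp only: norm_mult norm_of_real abs_of_nonneg mult_nonneg_nonneg)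
    also have "\<dots> \<le> d * (1 - (norm b)\<^sup>2)"
      using d abc(3) by (intro mult_left_le) auto
    finally show "norm (of_real (d * (1 - (norm b)\<^sup>2)) * c) \<le> d * (1 - (norm b)\<^sup>2)" .
  qed
  also have "\<dots> = \<nu> * (norm a)\<^sup>2 + d"
    by (simp add: algebra_simps)
  also have "\<dots> \<le> \<nu> * (norm a)\<^sup>2 + \<nu> * d"
    using mult_right_mono[OF assms(5) d(1)] by simp
  also have "\<dots> = \<nu>"
    using d(2) by (metis distrib_left mult.right_neutral)
  finally show ?thesis .
qed

text \<open>By the triangle inequality the modulus is at most a weighted mean of
  \<open>norm b\<close> and \<nu>, with weights \<open>d\<close> and
  \<open>(norm a)\<^sup>2\<close>.\<close>

lemma norm_second_coeff_combination_le:
  assumes w: "w holomorphic_on unit_disc" "w ` unit_disc \<subseteq> unit_disc" "w 0 = 0" and "1 \<le> \<nu>"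
  defines "W \<equiv> fps_expansion w 0"
  shows "norm (W $ 2 + of_real \<nu> * (W $ 1)\<^sup>2) \<le> \<nu>"
proof -
  obtain a b :: complex where ab: "norm a \<le> 1" "norm b \<le> 1" "W $ 1 = a" "W $ 2 = (1 - (norm a)\<^sup>2) * b"
    using schwarz_function_coeffs[OF w] unfolding W_def by metis
  define d where "d = 1 - (norm a)\<^sup>2"
  have d: "0 \<le> d" "(norm a)\<^sup>2 + d = 1"
    using ab(1) by (auto simp: d_def power_le_one)
  have "norm (W $ 2 + of_real \<nu> * (W $ 1)\<^sup>2) \<le> d * norm b + \<nu> * (norm a)\<^sup>2"
  proof -
    have "W $ 2 + of_real \<nu> * (W $ 1)\<^sup>2 = of_real d * b + of_real \<nu> * a\<^sup>2"
      unfolding ab by (simp add: d_def)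
    then show ?thesis
      using norm_triangle_ineq[of "of_real d * b" "of_real \<nu> * a\<^sup>2"] d(1) \<open>1 \<le> \<nu>\<close>
      by (simp add: norm_mult norm_power)
  qed
  also have "\<dots> \<le> \<nu> * d + \<nu> * (norm a)\<^sup>2"
    using mult_left_le[OF ab(2) d(1)] mult_right_mono[OF \<open>1 \<le> \<nu>\<close> d(1)] by simp
  also have "\<dots> = \<nu>"
    using d(2) by (metis add.commute distrib_left mult.right_neutral)
  finally show ?thesis .
qed

section \<open>Analyticity of \<open>B_fun\<close> on the disc\<close>

lemma one_minus_Ln_nonzero:
  assumes "z \<in> unit_disc"
  shows "1 - Ln (1 + z) \<noteq> 0"
proof
  assume *: "1 - Ln (1 + z) = 0"
  have "1 + z \<noteq> 0"
    using assms by (auto simp: add_eq_0_iff)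
  then have "1 + z = exp 1"
    using * exp_Ln[of "1 + z"] by simp
  \<comment> \<open>The only candidate for a zero is e - 1, which is at least 1 and so lies outside
    the open disc.\<close>
  then have "z = of_real (exp 1 - 1)"
    by (simp add: algebra_simps exp_of_real[symmetric])
  moreover have "exp 1 \<ge> (2 :: real)"
    using exp_ge_add_one_self[of 1] by simp
  ultimately show False
    using assms by (simp del: of_real_diff)
qed

lemma one_plus_notin_nonpos_Reals:
  assumes "z \<in> unit_disc"
  shows "1 + z \<notin> \<real>\<^sub>\<le>\<^sub>0"
proof -
  have "Re (1 + z) > 0"
    using assms abs_Re_le_cmod[of z] by simp
  then show ?thesis
    by (auto simp: complex_nonpos_Reals_iff)
qed

text \<open>Writing the derivative through \<open>B_fun\<close> itself is what later yields a
  differential equation free of logarithms.\<close>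

lemma has_field_derivative_B_fun:
  assumes "z \<in> unit_disc"
  shows "(B_fun has_field_derivative (B_fun z)\<^sup>2 / (1 + z)) (at z)"
  unfolding B_fun_def
  by (rule derivative_eq_intros refl | use assms one_minus_Ln_nonzero one_plus_notin_nonpos_Reals in force)+
    (use one_minus_Ln_nonzero[OF assms] in \<open>simp add: power2_eq_square divide_simps\<close>)

lemma holomorphic_B_fun: "B_fun holomorphic_on unit_disc"
  using has_field_derivative_B_fun by (subst holomorphic_on_open) blast+

lemma B_fun_0 [simp]: "B_fun 0 = 1"
  by (simp add: B_fun_def)

section \<open>Coefficients and construction of functions in \<open>starlike_B\<close>\<close>

lemma taylor_coeff_eq: "taylor_coeff f n = fps_expansion f 0 $ n"
  by (simp add: taylor_coeff_def fps_expansion_def)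

text \<open>The quotient \<open>q = z f' / f = B \<circ> w\<close> satisfies \<open>(1 + w) q' = q\<^sup>2 w'\<close>, which
  determines its coefficients without expanding the logarithm.\<close>

lemma starlike_B_coeffs:
  assumes f: "f \<in> starlike_B" and w: "w holomorphic_on unit_disc" "w ` unit_disc \<subseteq> unit_disc" "w 0 = 0"
    and qw: "\<forall>z\<in>unit_disc. log_deriv_quotient f z = B_fun (w z)"
  defines "W \<equiv> fps_expansion w 0"
  shows "taylor_coeff f 3 = (W $ 2 + of_real (3 / 2) * (W $ 1)\<^sup>2) / 2"
    and "taylor_coeff f 4 =
      (W $ 3 + of_real (5 / 2) * (W $ 1) * (W $ 2) + of_real (19 / 12) * (W $ 1) ^ 3) / 3"
proof -
  define q where "q = (\<lambda>z. B_fun (w z))"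
  define F where "F = fps_expansion f 0"
  define Q where "Q = fps_expansion q 0"
  have f': "f holomorphic_on unit_disc" "f 0 = 0" "deriv f 0 = 1"
    and f_nz: "\<And>z. z \<in> unit_disc - {0} \<Longrightarrow> f z \<noteq> 0"
    using f by (auto simp: starlike_B_def class_A_def)
  have q: "q holomorphic_on unit_disc"
    unfolding q_def using holomorphic_on_compose_gen[OF w(1) holomorphic_B_fun w(2)]
    by (simp add: o_def)
  have F: "f has_fps_expansion F" and Q: "q has_fps_expansion Q" and W: "w has_fps_expansion W"
    using f' q w by (auto simp: F_def Q_def W_def)
  have nth_0: "F $ 0 = 0" "F $ 1 = 1" "Q $ 0 = 1" "W $ 0 = 0"
    using f' w by (auto simp: F_def Q_def W_def fps_expansion_def q_def)
  have "(1 + W) * fps_deriv Q = Q * Q * fps_deriv W"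
  proof (rule fps_expansion_eqI)
    show "(\<lambda>z. (1 + w z) * deriv q z) has_fps_expansion (1 + W) * fps_deriv Q"
      by (intro fps_expansion_intros Q W)
    show "(\<lambda>z. q z * q z * deriv w z) has_fps_expansion Q * Q * fps_deriv W"
      by (intro fps_expansion_intros Q W)
    fix z :: complex assume z: "z \<in> unit_disc"
    then have wz: "w z \<in> unit_disc"
      using w by blast
    have "(w has_field_derivative deriv w z) (at z)"
      using w(1) z holomorphic_derivI open_ball by blast
    then have "(q has_field_derivative (B_fun (w z))\<^sup>2 / (1 + w z) * deriv w z) (at z)"
      unfolding q_def by (rule DERIV_chain2[where g = w, OF has_field_derivative_B_fun[OF wz]])
    then have "deriv q z = (q z)\<^sup>2 / (1 + w z) * deriv w z"
      by (simp add: DERIV_imp_deriv q_def)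
    moreover have "1 + w z \<noteq> 0"
      using one_plus_notin_nonpos_Reals[OF wz] by auto
    ultimately show "(1 + w z) * deriv q z = q z * q z * deriv w z"
      by (simp add: power2_eq_square)
  qed
  note ode = arg_cong[OF this, of "\<lambda>H. H $ n" for n]
  have "fps_X * fps_deriv F = F * Q"
  proof (rule fps_expansion_eqI)
    show "(\<lambda>z. z * deriv f z) has_fps_expansion fps_X * fps_deriv F"
      by (intro fps_expansion_intros F)
    show "(\<lambda>z. f z * q z) has_fps_expansion F * Q"
      by (intro fps_expansion_intros F Q)
    \<comment> \<open>Away from the origin \<open>f z\<close> is nonzero and can be multiplied out;
      at the origin both sides vanish.\<close>
    show "z * deriv f z = f z * q z" if "z \<in> unit_disc" for z
      using bspec[OF qw that] f_nz[of z] f'(2) that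
      by (cases "z = 0") (auto simp: q_def log_deriv_quotient_def field_simps)
  qed
  note rec = arg_cong[OF this, of "\<lambda>H. H $ n" for n]
  \<comment> \<open>Differentiation shifts indices: coefficient \<open>n\<close> of the equation
    determines \<open>Q $ (n + 1)\<close>.\<close>
  have Q1: "Q $ 1 = W $ 1"
    using ode[of 0] nth_0 by simp
  have Q2: "Q $ 2 = W $ 2 + (W $ 1)\<^sup>2 / 2"
    using ode[of 1] nth_0 Q1 by (simp add: fps_low_coeffs field_simps)
  have Q3: "Q $ 3 = W $ 3 + W $ 1 * W $ 2 + (W $ 1) ^ 3 / 3"
    using ode[of 2] nth_0 Q1 Q2 by (simp add: fps_low_coeffs field_simps)
  \<comment> \<open>Coefficient \<open>n\<close> has \<open>n * F $ n\<close> on the left and, as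
    \<open>Q $ 0 = 1\<close>, a term \<open>F $ n\<close> on the right, leaving the factor
    \<open>n - 1\<close>.\<close>
  have F2: "F $ 2 = Q $ 1"
    using rec[of 2] nth_0 by (simp add: fps_low_coeffs)
  have F3: "2 * F $ 3 = Q $ 2 + F $ 2 * Q $ 1"
    using rec[of 3] nth_0 by (simp add: fps_low_coeffs algebra_simps)
  have F4: "3 * F $ 4 = Q $ 3 + F $ 2 * Q $ 2 + F $ 3 * Q $ 1"
    using rec[of 4] nth_0 by (simp add: fps_low_coeffs algebra_simps)
  show a3: "taylor_coeff f 3 = (W $ 2 + of_real (3 / 2) * (W $ 1)\<^sup>2) / 2"
    using F3 unfolding taylor_coeff_eq F_def[symmetric] F2 Q1 Q2
    by (simp add: field_simps power2_eq_square)
  have "3 * F $ 4 = W $ 3 + of_real (5 / 2) * (W $ 1) * (W $ 2) + of_real (19 / 12) * (W $ 1) ^ 3"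
    unfolding F4 F2 Q1 Q2 Q3 a3[unfolded taylor_coeff_eq, folded F_def]
    by (simp add: field_simps power2_eq_square power3_eq_cube)
  then show "taylor_coeff f 4 =
      (W $ 3 + of_real (5 / 2) * (W $ 1) * (W $ 2) + of_real (19 / 12) * (W $ 1) ^ 3) / 3"
    by (simp add: taylor_coeff_eq F_def field_simps)
qed

text \<open>Integrate the logarithmic derivative: if \<open>B_fun (w z) = 1 + z * p z\<close> and
  \<open>h0\<close> is a primitive of \<open>p\<close>, then \<open>z * exp (h0 z - h0 0)\<close>
  has the required quotient. The exponential excludes further zeros, and subtracting
  \<open>h0 0\<close> makes the derivative at 0 equal to 1.\<close>

lemma starlike_B_exists:
  assumes w: "w holomorphic_on unit_disc" "w ` unit_disc \<subseteq> unit_disc" "w 0 = 0"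
  obtains f where "f \<in> starlike_B" "\<forall>z\<in>unit_disc. log_deriv_quotient f z = B_fun (w z)"
proof -
  have q: "(\<lambda>z. B_fun (w z)) holomorphic_on unit_disc"
    using holomorphic_on_compose_gen[OF w(1) holomorphic_B_fun w(2)] by (simp add: o_def)
  obtain p where p: "p holomorphic_on unit_disc" "\<And>z. norm z < 1 \<Longrightarrow> B_fun (w z) - 1 = z * p z"
    using Schwarz3[OF holomorphic_on_diff[OF q holomorphic_on_const[of 1]]] w(3) by auto
  obtain h0 where h0: "\<And>z. z \<in> unit_disc \<Longrightarrow> (h0 has_field_derivative p z) (at z)"
    using holomorphic_convex_primitive'[OF convex_ball open_ball p(1)] at_within_open[OF _ open_ball]
    by metis
  define f where "f = (\<lambda>z. z * exp (h0 z - h0 0))"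
  have f: "(f has_field_derivative exp (h0 z - h0 0) * B_fun (w z)) (at z)" if "z \<in> unit_disc" for z
  proof -
    have "B_fun (w z) = 1 + z * p z"
      using p(2)[of z] that by (simp add: algebra_simps)
    then show ?thesis
      unfolding f_def
      by (auto intro!: derivative_eq_intros h0 that simp: algebra_simps)
  qed
  have quot: "log_deriv_quotient f z = B_fun (w z)" if "z \<in> unit_disc" for z
    using DERIV_imp_deriv[OF f[OF that]] w(3) by (auto simp: log_deriv_quotient_def f_def)
  have "f holomorphic_on unit_disc"
    using f by (subst holomorphic_on_open) blast+
  moreover have "log_deriv_quotient f holomorphic_on unit_disc"
    by (rule holomorphic_transform[OF q]) (simp add: quot)
  ultimately have "f \<in> starlike_B"
    using DERIV_imp_deriv[OF f[of 0]] w quot holomorphic_B_fun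
    by (auto simp: starlike_B_def class_A_def subordinate_def f_def)
  with quot that show ?thesis
    by blast
qed

section \<open>The bound and its sharpness\<close>

theorem theorem4p3:
  "(\<forall>f\<in>starlike_B. norm (T_2_3 f) \<le> 545 / 648) \<and>
   (\<exists>f\<in>starlike_B. norm (T_2_3 f) = 545 / 648)"
proof
  show "\<forall>f\<in>starlike_B. norm (T_2_3 f) \<le> 545 / 648"
  proof
    fix f assume f: "f \<in> starlike_B"
    then obtain w where w: "w holomorphic_on unit_disc" "w ` unit_disc \<subseteq> unit_disc" "w 0 = 0"
      and qw: "\<forall>z\<in>unit_disc. log_deriv_quotient f z = B_fun (w z)"
      by (auto simp: starlike_B_def subordinate_def)
    have "norm (taylor_coeff f 3) \<le> 3 / 4"
      using norm_second_coeff_combination_le[OF w, of "3 / 2"]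
      by (simp add: starlike_B_coeffs(1)[OF f w qw] norm_divide)
    then have "(norm (taylor_coeff f 3))\<^sup>2 \<le> (3 / 4)\<^sup>2"
      by (intro power_mono) auto
    moreover have "norm (taylor_coeff f 4) \<le> 19 / 36"
      \<comment> \<open>The hypotheses hold since 25/4 \<le> 19/3 and 1 \<le> 19/12.\<close>
      using prokhorov_szynal[OF w, of "5 / 2" "19 / 12"]
      by (simp add: starlike_B_coeffs(2)[OF f w qw] norm_divide power2_eq_square)
    then have "(norm (taylor_coeff f 4))\<^sup>2 \<le> (19 / 36)\<^sup>2"
      by (intro power_mono) auto
    moreover have "norm (T_2_3 f) \<le> (norm (taylor_coeff f 3))\<^sup>2 + (norm (taylor_coeff f 4))\<^sup>2"
      unfolding T_2_3_def using norm_triangle_ineq4 by (metis norm_power)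
    ultimately show "norm (T_2_3 f) \<le> 545 / 648"
      by (simp add: power2_eq_square)
  qed
  define w :: "complex \<Rightarrow> complex" where "w = (\<lambda>z. \<i> * z)"
  have w: "w holomorphic_on unit_disc" "w ` unit_disc \<subseteq> unit_disc" "w 0 = 0"
    by (auto simp: w_def norm_mult intro!: holomorphic_intros)
  obtain f where f: "f \<in> starlike_B"
    and qw: "\<forall>z\<in>unit_disc. log_deriv_quotient f z = B_fun (w z)"
    using starlike_B_exists[OF w] by blast
  have "fps_expansion w 0 = fps_const \<i> * fps_X"
  proof (rule fps_expansion_eqI)
    show "w has_fps_expansion fps_expansion w 0"
      using w by auto
    show "(\<lambda>z. \<i> * z) has_fps_expansion fps_const \<i> * fps_X"
      by (intro fps_expansion_intros)
  qed (simp add: w_def)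
  \<comment> \<open>Only \<open>W $ 1 = \<i>\<close> survives, so the coefficients are -3/4 and
    -19/36 times \<open>\<i>\<close>, and the difference of squares becomes a sum.\<close>
  then have T: "T_2_3 f = 545 / 648"
    unfolding T_2_3_def starlike_B_coeffs[OF f w qw]
    by (simp add: field_simps)
  show "\<exists>f\<in>starlike_B. norm (T_2_3 f) = 545 / 648"
    using f by (rule bexI[rotated]) (simp only: T norm_divide norm_numeral)
qed

end
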